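(* Let $G$ be a finite non-cyclic group. Then the complement $\overline{\mathcal{P}_E(G)}$ of the enhanced power graph of $G$ has just one connected component, apart from isolated vertices.
   Context: The enhanced power graph $\mathcal{P}_E(G)$ of a group $G$ is the simple undirected graph with vertex set $G$ in which two distinct vertices $x,y$ are adjacent if $x,y\in\langle z\rangle$ for some $z\in G$. Its complement $\overline{\mathcal{P}_E(G)}$ has the same vertex set $G$, and distinct $x,y$ are adjacent in it if and only if they are not adjacent in $\mathcal{P}_E(G)$. An isolated vertex is a vertex with no neighbours. *)

theory Defs
  imports "HOL-Algebra.Elementary_Groups" "Graph_Theory.Graph_Theory"
begin

text \<open>A simple undirected graph is a \<open>pair_pre_digraph\<close> in the sense of
  \<^locale>\<open>pair_bidirected_digraph\<close> (\<^locale>\<open>pair_graph\<close> if finite): every edge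
  \<open>{x, y}\<close> is stored as the two arcs \<open>(x, y)\<close> and \<open>(y, x)\<close>, and there are no loops.
  On such symmetric graphs strong connectivity is ordinary connectivity, so
  \<open>pre_digraph.sccs\<close> is the set of connected components.\<close>

definition enhanced_power_graph :: "('a, 'b) monoid_scheme \<Rightarrow> 'a pair_pre_digraph" where
  "enhanced_power_graph G =
     \<lparr>pverts = carrier G,
      parcs = {(x, y). x \<in> carrier G \<and> y \<in> carrier G \<and> x \<noteq> y \<and>
                       (\<exists>z \<in> carrier G. x \<in> generate G {z} \<and> y \<in> generate G {z})}\<rparr>"

definition graph_complement :: "'a pair_pre_digraph \<Rightarrow> 'a pair_pre_digraph" where
  "graph_complement \<Gamma> =
     \<lparr>pverts = pverts \<Gamma>,
      parcs = {(x, y). x \<in> pverts \<Gamma> \<and> y \<in> pverts \<Gamma> \<and> x \<noteq> y \<and> (x, y) \<notin> parcs \<Gamma>}\<rparr>"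

definition isolated_vertex :: "'a pair_pre_digraph \<Rightarrow> 'a \<Rightarrow> bool" where
  "isolated_vertex \<Gamma> v \<longleftrightarrow> v \<in> pverts \<Gamma> \<and> (\<forall>u \<in> pverts \<Gamma>. (v, u) \<notin> parcs \<Gamma>)"

lemma pair_bidirected_enhanced_power_graph:
  "pair_bidirected_digraph (enhanced_power_graph G)"
  by unfold_locales (auto simp: enhanced_power_graph_def symmetric_def sym_def)

lemma pair_graph_enhanced_power_graph:
  assumes "finite (carrier G)"
  shows "pair_graph (enhanced_power_graph G)"
proof -
  have "parcs (enhanced_power_graph G) \<subseteq> carrier G \<times> carrier G"
    by (auto simp: enhanced_power_graph_def)
  then have "finite (parcs (enhanced_power_graph G))"
    using assms finite_subset by blast
  then show ?thesis
    using assms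
    by unfold_locales (auto simp: enhanced_power_graph_def symmetric_def sym_def)
qed

lemma pair_graph_graph_complement:
  assumes "pair_graph \<Gamma>"
  shows "pair_graph (graph_complement \<Gamma>)"
proof -
  interpret pair_graph \<Gamma> by fact
  have "parcs (graph_complement \<Gamma>) \<subseteq> pverts \<Gamma> \<times> pverts \<Gamma>"
    by (auto simp: graph_complement_def)
  then have "finite (parcs (graph_complement \<Gamma>))"
    using pair_finite_verts finite_subset by blast
  moreover have "(y, x) \<in> parcs \<Gamma>" if "(x, y) \<in> parcs \<Gamma>" for x y
    using pair_sym_arcs that by (auto simp: symmetric_def sym_def)
  ultimately show ?thesis
    using pair_finite_verts
    by unfold_locales (auto simp: graph_complement_def symmetric_def sym_def)
qed

end

theory Submission
  imports Defs
begin

text \<open>Two elements are non-adjacent in the enhanced power graph exactly when no cyclic subgroup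
  contains both.  The generators of maximal cyclic subgroups serve as hubs of the complement.

  Suppose that \<open>x\<close> is not isolated in the complement, say \<open>x\<close> and \<open>a\<close> lie in no common cyclic
  subgroup.  In a finite group \<open>a\<close> lies in a maximal cyclic subgroup \<open>\<langle>m\<rangle>\<close>, and \<open>x \<notin> \<langle>m\<rangle>\<close> by the
  choice of \<open>a\<close>.  By maximality \<open>\<langle>m\<rangle>\<close> is the only cyclic subgroup containing \<open>m\<close>, so \<open>m\<close> is adjacent in
  the complement to everything outside \<open>\<langle>m\<rangle>\<close>, in particular to \<open>x\<close>.  If \<open>y\<close> is another non-isolated
  vertex and \<open>n\<close> is its hub, then either \<open>\<langle>m\<rangle> = \<langle>n\<rangle>\<close>, and \<open>x, m, y\<close> is a walk, or \<open>m\<close> and \<open>n\<close> are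
  themselves adjacent, and \<open>x, m, n, y\<close> is a walk.  So all non-isolated vertices are in one component
  (\<open>non_isolated_reachable\<close>).  The component exists since in a non-cyclic group
  every \<open>\<langle>m\<rangle>\<close> misses some element.\<close>

text \<open>Passing from walks to components: the component of an isolated vertex is the vertex alone, so
  a component that is not of this form contains a non-isolated vertex.\<close>

lemma (in pair_wf_digraph) unique_scc_apart_from_isolated:
  assumes u: "u \<in> pverts G" "\<not> isolated_vertex G u"
    and reach: "\<And>v w. \<lbrakk>v \<in> pverts G; w \<in> pverts G; \<not> isolated_vertex G v; \<not> isolated_vertex G w\<rbrakk>
      \<Longrightarrow> v \<rightarrow>\<^sup>*\<^bsub>with_proj G\<^esub> w"
  shows "\<exists>!C. C \<in> sccs \<and> \<not> (\<exists>v. isolated_vertex G v \<and> verts C = {v})"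
proof -
  have "scc_of u \<in> sccs_verts"
    using u by (simp add: scc_of_in_sccs_verts)
  then obtain C where C: "C \<in> sccs" "verts C = scc_of u"
    unfolding sccs_verts_conv by auto
  have "u \<in> verts C"
    using u C by (simp add: in_scc_of_self)
  have unique: "D = C"
    if D: "D \<in> sccs" "\<not> (\<exists>v. isolated_vertex G v \<and> verts D = {v})" for D
  proof -
    obtain w where w: "w \<in> pverts G" "verts D = scc_of w"
      using D(1) sccs_verts_conv sccs_verts_conv_scc_of by (metis imageE image_eqI with_proj_simps(1))
    have "\<not> isolated_vertex G w"
    proof
      assume iso: "isolated_vertex G w"
      have "v = w" if "w \<rightarrow>\<^sup>*\<^bsub>with_proj G\<^esub> v" for v
        using that
      proof (cases rule: converse_reachable_cases)
        case (step x)
        then show ?thesis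
          using iso by (auto simp: isolated_vertex_def dest: adj_in_verts)
      qed simp
      then have "scc_of w = {w}"
        using w by (auto simp: scc_of_def)
      with iso w D show False by auto
    qed
    with reach u w have "w \<in> scc_of u"
      by (simp add: scc_of_def)
    with w have "w \<in> verts C \<inter> verts D"
      using C by (simp add: in_scc_of_self)
    with scc_disj[OF C(1) D(1)] show "D = C"
      by blast
  qed
  show ?thesis
  proof (rule ex1I[of _ C])
    show "C \<in> sccs \<and> \<not> (\<exists>v. isolated_vertex G v \<and> verts C = {v})"
      using C u \<open>u \<in> verts C\<close> by auto
  qed (use unique in blast)
qed

definition in_common_cyclic :: "('a, 'b) monoid_scheme \<Rightarrow> 'a \<Rightarrow> 'a \<Rightarrow> bool" where
  "in_common_cyclic G x y \<longleftrightarrow> (\<exists>z \<in> carrier G. x \<in> generate G {z} \<and> y \<in> generate G {z})"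

definition maximal_cyclic_generator :: "('a, 'b) monoid_scheme \<Rightarrow> 'a \<Rightarrow> bool" where
  "maximal_cyclic_generator G m \<longleftrightarrow> m \<in> carrier G \<and>
     (\<forall>z \<in> carrier G. generate G {m} \<subseteq> generate G {z} \<longrightarrow> generate G {z} = generate G {m})"

lemma in_common_cyclic_sym: "in_common_cyclic G x y \<longleftrightarrow> in_common_cyclic G y x"
  by (auto simp: in_common_cyclic_def)

context group
begin

lemma in_common_cyclic_refl: "x \<in> carrier G \<Longrightarrow> in_common_cyclic G x x"
  by (auto simp: in_common_cyclic_def intro: generate.incl)

text \<open>Every element lies in a cyclic subgroup, so elements of no common cyclic subgroup are distinct.\<close>

lemma complement_arc_iff:
  "(x, y) \<in> parcs (graph_complement (enhanced_power_graph G)) \<longleftrightarrow>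
     x \<in> carrier G \<and> y \<in> carrier G \<and> \<not> in_common_cyclic G x y"
  using in_common_cyclic_refl
  by (auto simp: graph_complement_def enhanced_power_graph_def in_common_cyclic_def)

lemma in_maximal_cyclic:
  assumes "finite (carrier G)" "a \<in> carrier G"
  obtains m where "maximal_cyclic_generator G m" "a \<in> generate G {m}"
proof -
  define A where "A = {H. \<exists>z \<in> carrier G. H = generate G {z} \<and> a \<in> H}"
  have "finite A"
    using assms(1) by (simp add: A_def)
  moreover have "generate G {a} \<in> A"
    using assms(2) by (auto simp: A_def intro: generate.incl)
  ultimately obtain H where H: "H \<in> A" "\<And>K. \<lbrakk>K \<in> A; H \<subseteq> K\<rbrakk> \<Longrightarrow> H = K"
    using finite_has_maximal[of A] by blast
  then obtain m where m: "m \<in> carrier G" "H = generate G {m}" "a \<in> H"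
    by (auto simp: A_def)
  have "generate G {z} = generate G {m}"
    if "z \<in> carrier G" "generate G {m} \<subseteq> generate G {z}" for z
    using H(2)[of "generate G {z}"] that m by (auto simp: A_def)
  with m have "maximal_cyclic_generator G m"
    by (simp add: maximal_cyclic_generator_def)
  with m show thesis
    using that by blast
qed

text \<open>A cyclic subgroup that contains \<open>m\<close> contains \<open>\<langle>m\<rangle>\<close>, hence equals it.\<close>

lemma in_common_cyclic_maximal_iff:
  assumes "maximal_cyclic_generator G m"
  shows "in_common_cyclic G m x \<longleftrightarrow> x \<in> generate G {m}"
proof
  assume "in_common_cyclic G m x"
  then obtain z where z: "z \<in> carrier G" "m \<in> generate G {z}" "x \<in> generate G {z}"
    by (auto simp: in_common_cyclic_def)
  then have "generate G {m} \<subseteq> generate G {z}"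
    by (intro generate_subgroup_incl generate_is_subgroup) auto
  with assms z show "x \<in> generate G {m}"
    by (auto simp: maximal_cyclic_generator_def)
next
  assume "x \<in> generate G {m}"
  with assms show "in_common_cyclic G m x"
    by (auto simp: maximal_cyclic_generator_def in_common_cyclic_def intro: generate.incl)
qed

lemma generate_eq_of_maximal_in_common_cyclic:
  assumes "maximal_cyclic_generator G m" "maximal_cyclic_generator G n" "in_common_cyclic G m n"
  shows "generate G {m} = generate G {n}"
proof -
  have "n \<in> generate G {m}"
    using assms in_common_cyclic_maximal_iff by blast
  moreover have m: "m \<in> carrier G"
    using assms(1) by (simp add: maximal_cyclic_generator_def)
  ultimately have "generate G {n} \<subseteq> generate G {m}"
    by (intro generate_subgroup_incl generate_is_subgroup) auto
  with assms(2) m show ?thesis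
    by (simp add: maximal_cyclic_generator_def)
qed

lemma non_isolated_obtains_maximal:
  assumes "finite (carrier G)" "x \<in> carrier G"
    and "\<not> isolated_vertex (graph_complement (enhanced_power_graph G)) x"
  obtains m where "maximal_cyclic_generator G m" "x \<notin> generate G {m}"
proof -
  obtain a where a: "a \<in> carrier G" "\<not> in_common_cyclic G x a"
    using assms complement_arc_iff[of x]
    by (auto simp: isolated_vertex_def graph_complement_def enhanced_power_graph_def)
  obtain m where m: "maximal_cyclic_generator G m" "a \<in> generate G {m}"
    using in_maximal_cyclic[OF assms(1) a(1)] .
  with a have "x \<notin> generate G {m}"
    by (auto simp: in_common_cyclic_def maximal_cyclic_generator_def)
  with m that show thesis by blast
qed

lemma non_isolated_reachable:
  fixes G' :: "'a pair_pre_digraph"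
  defines "G' \<equiv> graph_complement (enhanced_power_graph G)"
  assumes fin: "finite (carrier G)"
    and x: "x \<in> carrier G" "\<not> isolated_vertex G' x"
    and y: "y \<in> carrier G" "\<not> isolated_vertex G' y"
  shows "x \<rightarrow>\<^sup>*\<^bsub>with_proj G'\<^esub> y"
proof -
  interpret H: pair_graph G'
    unfolding G'_def by (intro pair_graph_graph_complement pair_graph_enhanced_power_graph fin)
  have arc: "(u, v) \<in> parcs G'"
    if "u \<in> carrier G" "v \<in> carrier G" "\<not> in_common_cyclic G u v" for u v
    using that complement_arc_iff by (simp add: G'_def)
  obtain m where m: "maximal_cyclic_generator G m" "x \<notin> generate G {m}"
    using non_isolated_obtains_maximal[OF fin] x unfolding G'_def by blast
  obtain n where n: "maximal_cyclic_generator G n" "y \<notin> generate G {n}"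
    using non_isolated_obtains_maximal[OF fin] y unfolding G'_def by blast
  have mn: "m \<in> carrier G" "n \<in> carrier G"
    using m n by (auto simp: maximal_cyclic_generator_def)
  have xm: "(x, m) \<in> parcs G'"
    using arc x mn m in_common_cyclic_maximal_iff in_common_cyclic_sym by metis
  have ny: "(n, y) \<in> parcs G'"
    using arc y mn n in_common_cyclic_maximal_iff by metis
  show ?thesis
  proof (cases "in_common_cyclic G m n")
    case True
    then have "y \<notin> generate G {m}"
      using generate_eq_of_maximal_in_common_cyclic m n by simp
    then have "(m, y) \<in> parcs G'"
      using arc y mn m in_common_cyclic_maximal_iff by metis
    then show ?thesis
      by (intro H.adj_reachable_trans[OF xm] H.reachable_adjI)
  next
    case False
    then have "(m, n) \<in> parcs G'"
      using arc mn by blast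
    then show ?thesis
      by (intro H.adj_reachable_trans[OF xm] H.adj_reachable_trans[OF _ H.reachable_adjI[OF ny]])
  qed
qed

lemma non_cyclic_obtains_non_isolated:
  assumes fin: "finite (carrier G)" and "\<not> cyclic_group G"
  obtains u where "u \<in> carrier G"
    "\<not> isolated_vertex (graph_complement (enhanced_power_graph G)) u"
proof -
  obtain m where m: "maximal_cyclic_generator G m"
    using in_maximal_cyclic[OF fin one_closed] .
  then have mG: "m \<in> carrier G"
    by (simp add: maximal_cyclic_generator_def)
  have "generate G {m} \<noteq> carrier G"
  proof
    assume "generate G {m} = carrier G"
    with mG have "subgroup_generated G {m} = G"
      by (simp add: subgroup_generated_def)
    with mG assms(2) show False
      by (auto simp: cyclic_group_def)
  qed
  then obtain g where g: "g \<in> carrier G" "g \<notin> generate G {m}"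
    using generate_incl[of "{m}"] mG by blast
  with m mG have "(m, g) \<in> parcs (graph_complement (enhanced_power_graph G))"
    by (simp add: complement_arc_iff in_common_cyclic_maximal_iff)
  with g have "\<not> isolated_vertex (graph_complement (enhanced_power_graph G)) m"
    by (auto simp: isolated_vertex_def graph_complement_def enhanced_power_graph_def)
  with mG that show thesis by blast
qed

end

theorem theorem3p2:
  fixes G :: "('a, 'b) monoid_scheme"
  assumes "group G"
    and "finite (carrier G)"
    and "\<not> cyclic_group G"
  shows "\<exists>!C. C \<in> pre_digraph.sccs (with_proj (graph_complement (enhanced_power_graph G))) \<and>
           \<not> (\<exists>v. isolated_vertex (graph_complement (enhanced_power_graph G)) v \<and> verts C = {v})"
proof -
  interpret group G by fact
  interpret H: pair_graph "graph_complement (enhanced_power_graph G)"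
    by (intro pair_graph_graph_complement pair_graph_enhanced_power_graph assms)
  have pverts: "pverts (graph_complement (enhanced_power_graph G)) = carrier G"
    by (simp add: graph_complement_def enhanced_power_graph_def)
  obtain u where "u \<in> carrier G"
    "\<not> isolated_vertex (graph_complement (enhanced_power_graph G)) u"
    using non_cyclic_obtains_non_isolated assms by blast
  then show ?thesis
    using non_isolated_reachable assms(2)
    by (intro H.unique_scc_apart_from_isolated) (auto simp: pverts)
qed

end
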